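(* Let $\lambda$ be a nonzero real number and $m$ a positive integer. For every integer $n\ge 0$, $$(x)_{n,\lambda}=\sum_{k=0}^{n}\Big\{\sum_{l=k}^{n}\sum_{i=0}^{n-l}\binom{n}{l}S_{1,\frac{\lambda}{m}}(l,k)\,S_{1}(n-l,i)\,m^{n-k-i}(-1)^{i}\Big\}d_{m,\lambda}(k,x).$$
   Context: For $\mu\neq 0$: $(x)_{0,\mu}=1$ and $(x)_{n,\mu}=x(x-\mu)\cdots(x-(n-1)\mu)$ for $n\ge1$; $e_\mu^{x}(t)=\sum_{k\ge0}(x)_{k,\mu}\frac{t^k}{k!}=(1+\mu t)^{x/\mu}$, $e_\mu(t)=e^1_\mu(t)$, and $\log_\mu(1+t)=\frac{1}{\mu}\big((1+t)^\mu-1\big)$. The degenerate Stirling numbers of the first kind $S_{1,\mu}(n,k)$ are defined by $\frac{1}{k!}(\log_\mu(1+t))^k=\sum_{n\ge k}S_{1,\mu}(n,k)\frac{t^n}{n!}$ (used here with $\mu=\lambda/m$). $S_1(n,k)$ are the (signed) Stirling numbers of the first kind: $x(x-1)\cdots(x-n+1)=\sum_{k=0}^{n}S_1(n,k)x^k$. The degenerate Whitney numbers of the second kind are defined by $e_\lambda(t)\frac{1}{k!}\Big(\frac{e_\lambda^{m}(t)-1}{m}\Big)^k=\sum_{n\ge k}W_{m,\lambda}(n,k)\frac{t^n}{n!}$, and the fully degenerate Dowling polynomials are $d_{m,\lambda}(n,x)=\sum_{k=0}^{n}W_{m,\lambda}(n,k)(x)_{k,\lambda}$. *)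

theory Defs
  imports Complex_Main "HOL-Computational_Algebra.Computational_Algebra"
begin

text \<open>All generating functions are formal power series in $t$ over the reals.\<close>

definition dfact :: "real \<Rightarrow> nat \<Rightarrow> real \<Rightarrow> real"
  where "dfact \<mu> n x = (\<Prod>i<n. x - of_nat i * \<mu>)"

definition dexp :: "real \<Rightarrow> real \<Rightarrow> real fps"
  where "dexp \<mu> x = Abs_fps (\<lambda>k. dfact \<mu> k x / fact k)"

text \<open>The series for $\log_\mu(1+t)$; here \<^term>\<open>fps_binomial \<mu>\<close> is the series $(1+t)^\mu$.\<close>

definition dlog :: "real \<Rightarrow> real fps"
  where "dlog \<mu> = fps_const (1 / \<mu>) * (fps_binomial \<mu> - 1)"

definition dstirling1 :: "real \<Rightarrow> nat \<Rightarrow> nat \<Rightarrow> real"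
  where "dstirling1 \<mu> n k = fact n * fps_nth (fps_const (1 / fact k) * dlog \<mu> ^ k) n"

text \<open>The signed numbers; \<open>stirling\<close> in \<open>HOL-Combinatorics\<close> is the unsigned version.\<close>

definition stirling1 :: "nat \<Rightarrow> nat \<Rightarrow> int"
  where "stirling1 n k = poly.coeff (\<Prod>i<n. [:- int i, 1:]) k"

definition dwhitney2 :: "nat \<Rightarrow> real \<Rightarrow> nat \<Rightarrow> nat \<Rightarrow> real"
  where "dwhitney2 m \<mu> n k = fact n * fps_nth
    (dexp \<mu> 1 * fps_const (1 / fact k) * (fps_const (1 / of_nat m) * (dexp \<mu> (of_nat m) - 1)) ^ k) n"

definition ddowling :: "nat \<Rightarrow> real \<Rightarrow> nat \<Rightarrow> real \<Rightarrow> real"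
  where "ddowling m \<mu> n x = (\<Sum>k\<le>n. dwhitney2 m \<mu> n k * dfact \<mu> k x)"

lemma dexp_binomial:
  assumes "\<mu> \<noteq> 0"
  shows "dexp \<mu> x = fps_binomial (x / \<mu>) oo (fps_const \<mu> * fps_X)"
proof (rule fps_ext)
  fix n
  have "(\<Prod>i<n. x - of_nat i * \<mu>) = (\<Prod>i<n. \<mu> * (x / \<mu> - of_nat i))"
    using assms by (intro prod.cong) (auto simp: field_simps)
  also have "\<dots> = \<mu> ^ n * (\<Prod>i<n. x / \<mu> - of_nat i)"
    by (simp add: prod.distrib)
  finally show "fps_nth (dexp \<mu> x) n = fps_nth (fps_binomial (x / \<mu>) oo (fps_const \<mu> * fps_X)) n"
    by (simp add: dexp_def dfact_def fps_compose_linear gbinomial_prod_rev lessThan_atLeast0)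
qed

lemma fps_nth_power_zero_below:
  fixes f :: "real fps"
  assumes "fps_nth f 0 = 0" "n < k"
  shows "fps_nth (f ^ k) n = 0"
  using assms by (auto dest: startsby_zero_power_prefix)

lemma dstirling1_gf:
  "fps_const (1 / fact k) * dlog \<mu> ^ k =
     Abs_fps (\<lambda>n. if k \<le> n then dstirling1 \<mu> n k / fact n else 0)"
proof -
  have "fps_nth (dlog \<mu>) 0 = 0"
    by (simp add: dlog_def)
  then show ?thesis
    by (intro fps_ext) (auto simp: dstirling1_def fps_nth_power_zero_below)
qed

lemma dwhitney2_gf:
  "dexp \<mu> 1 * fps_const (1 / fact k) * (fps_const (1 / of_nat m) * (dexp \<mu> (of_nat m) - 1)) ^ k =
     Abs_fps (\<lambda>n. if k \<le> n then dwhitney2 m \<mu> n k / fact n else 0)"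
proof -
  define g where "g = fps_const (1 / of_nat m) * (dexp \<mu> (of_nat m) - 1)"
  define h where "h = dexp \<mu> 1 * fps_const (1 / fact k) * g ^ k"
  have "fps_nth g 0 = 0"
    by (simp add: g_def dexp_def dfact_def)
  then have "fps_nth h n = 0" if "n < k" for n
    unfolding h_def fps_mult_nth[of _ "g ^ k"] using that
    by (intro sum.neutral) (auto simp: fps_nth_power_zero_below)
  then have "h = Abs_fps (\<lambda>n. if k \<le> n then dwhitney2 m \<mu> n k / fact n else 0)"
    unfolding dwhitney2_def g_def[symmetric] h_def[symmetric] by (intro fps_ext) simp
  then show ?thesis
    by (simp only: h_def g_def)
qed

lemma stirling1_falling:
  "(\<Prod>i<n. x - of_nat i) = (\<Sum>k\<le>n. of_int (stirling1 n k) * x ^ k)" for x :: real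
proof -
  define p where "p = (\<lambda>n. \<Prod>i<n. [:- int i, 1:])"
  have deg: "degree (p n) = n" for n
    by (simp add: p_def degree_prod_eq_sum_degree)
  have "poly (map_poly of_int (p n)) x = (\<Prod>i<n. x - of_nat i)" for n
  proof (induction n)
    case (Suc n)
    have "map_poly of_int (p n * [:- int n, 1:]) = (map_poly of_int (p n) * [:- of_nat n, 1:] :: real poly)"
      by (intro poly_eqI) (simp add: coeff_map_poly coeff_pCons split: nat.split)
    with Suc show ?case by (simp add: p_def del: mult_pCons_right)
  qed (simp add: p_def)
  then show ?thesis
    using deg by (simp add: poly_altdef stirling1_def p_def degree_map_poly coeff_map_poly)
qed

end

theory Submission
  imports Defs
begin

text \<open>
  Put $s = (e_\lambda^m(t) - 1)/m$. The generating function of the fully degenerate Dowling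
  polynomials is $e_\lambda(t)\, e_\lambda^x(s)$. Since $e_\lambda^y(t) = (1 + \lambda t)^{y/\lambda}$,
  the compositional inverse of $s$ is $t = \frac1m \log_{\lambda/m}(1 + m s)$, and
  $e_\lambda(t) = (1 + m s)^{1/m}$ under this substitution. Hence
  \[ e_\lambda^x(s) = (1 + m s)^{-1/m} \sum_k d_{m,\lambda}(k,x)\,
       \frac{1}{k!} \Big(\frac1m \log_{\lambda/m}(1 + m s)\Big)^k, \]
  and the identity follows by comparing coefficients of $s^n$; the Stirling numbers $S_1$ come
  from expanding the falling factorials of $-1/m$ in the binomial series.
\<close>

text \<open>Both sides have constant term 1 and solve \<open>(1 + fps_X) * f' = a * b * f\<close>;
  \<open>fps_binomial_ODE_unique'\<close> says that this determines the series.\<close>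

lemma fps_binomial_compose_binomial:
  fixes a b :: "'a::field_char_0"
  shows "fps_binomial a oo (fps_binomial b - 1) = fps_binomial (a * b)"
proof -
  define g where "g = fps_binomial b - (1 :: 'a fps)"
  have g0: "fps_nth g 0 = 0"
    by (simp add: g_def)
  have inv: "fps_binomial b * inverse (fps_binomial b) = 1"
    by (rule inverse_mult_eq_1') simp
  have "fps_deriv (fps_binomial a oo g) = (fps_const a * fps_binomial a / (1 + fps_X) oo g) * fps_deriv g"
    using g0 by (simp add: fps_compose_deriv fps_binomial_deriv)
  \<comment> \<open>Substituting \<open>g\<close> turns \<open>1 + fps_X\<close> into
    \<open>fps_binomial b\<close>; this denominator cancels against the same factor in
    \<open>fps_deriv g\<close>.\<close>
  also have "fps_const a * fps_binomial a / (1 + fps_X) oo g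
      = fps_const a * (fps_binomial a oo g) / fps_binomial b"
    using g0 by (simp add: fps_divide_compose fps_compose_mult_distrib fps_compose_add_distrib)
      (simp add: g_def)
  also have "fps_deriv g = fps_const b * fps_binomial b / (1 + fps_X)"
    by (simp add: g_def fps_binomial_deriv)
  also have "fps_const a * (fps_binomial a oo g) / fps_binomial b
      * (fps_const b * fps_binomial b / (1 + fps_X))
    = (fps_const a * fps_const b) * (fps_binomial a oo g) / (1 + fps_X)
      * (fps_binomial b * inverse (fps_binomial b))"
    by (simp add: fps_divide_unit mult_ac del: fps_const_mult)
  finally have "fps_deriv (fps_binomial a oo g)
      = fps_const (a * b) * (fps_binomial a oo g) / (1 + fps_X)"
    by (simp add: inv)
  then show ?thesis
    unfolding g_def by (intro iffD1[OF fps_binomial_ODE_unique']) simp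
qed

lemma fps_mult_compose_nth:
  fixes f g h :: "real fps"
  assumes "fps_nth h 0 = 0"
  shows "fps_nth (f * (g oo h)) n = (\<Sum>k=0..n. fps_nth g k * fps_nth (f * h ^ k) n)"
proof -
  \<comment> \<open>Extending the range from \<open>n - i\<close> to \<open>n\<close> adds only
    zeros, because \<open>h ^ k\<close> has no terms below degree \<open>k\<close>. The bound no
    longer depends on \<open>i\<close>, so the two sums can be swapped.\<close>
  have "fps_nth (g oo h) (n - i) = (\<Sum>k=0..n. fps_nth g k * fps_nth (h ^ k) (n - i))" for i
    unfolding fps_compose_nth using assms
    by (intro sum.mono_neutral_left) (auto simp: fps_nth_power_zero_below)
  then have "fps_nth (f * (g oo h)) n
      = (\<Sum>i=0..n. \<Sum>k=0..n. fps_nth g k * (fps_nth f i * fps_nth (h ^ k) (n - i)))"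
    by (simp add: fps_mult_nth sum_distrib_left mult_ac)
  also have "\<dots> = (\<Sum>k=0..n. fps_nth g k * fps_nth (f * h ^ k) n)"
    by (subst sum.swap) (simp add: fps_mult_nth sum_distrib_left)
  finally show ?thesis .
qed

text \<open>Expanding the outer exponential in powers of the inner series \<open>s\<close> weights
  the k-th column of Whitney numbers, generated by \<open>dexp \<mu> 1 * s ^ k\<close> divided by
  k!, with \<open>dfact \<mu> k x\<close>.\<close>

lemma ddowling_gf:
  "dexp \<mu> 1 * (dexp \<mu> x oo (fps_const (1 / of_nat m) * (dexp \<mu> (of_nat m) - 1)))
     = Abs_fps (\<lambda>n. ddowling m \<mu> n x / fact n)" (is "_ * (_ oo ?s) = _")
proof (rule fps_ext)
  fix n
  define s where "s = ?s"
  have "dwhitney2 m \<mu> n k = fact n * (1 / fact k * fps_nth (dexp \<mu> 1 * s ^ k) n)" for k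
  proof -
    have "dexp \<mu> 1 * fps_const (1 / fact k) * s ^ k = fps_const (1 / fact k) * (dexp \<mu> 1 * s ^ k)"
      by (simp only: mult_ac)
    then show ?thesis
      unfolding dwhitney2_def s_def[symmetric] by (simp only: fps_mult_left_const_nth)
  qed
  then have "ddowling m \<mu> n x / fact n
      = (\<Sum>k=0..n. dfact \<mu> k x / fact k * fps_nth (dexp \<mu> 1 * s ^ k) n)"
    by (simp add: ddowling_def sum_divide_distrib atMost_atLeast0 mult_ac)
  moreover have "fps_nth s 0 = 0"
    by (simp add: s_def dexp_def dfact_def)
  ultimately have "fps_nth (dexp \<mu> 1 * (dexp \<mu> x oo s)) n = ddowling m \<mu> n x / fact n"
    by (simp only: fps_mult_compose_nth dexp_def[of \<mu> x] fps_nth_Abs_fps)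
  then show "fps_nth (dexp \<mu> 1 * (dexp \<mu> x oo ?s)) n = fps_nth (Abs_fps (\<lambda>n. ddowling m \<mu> n x / fact n)) n"
    by (simp only: s_def fps_nth_Abs_fps)
qed

text \<open>If L is the inner series, then 1 + \<mu> L = (1 + c t)^(\<mu>/c); raising this to the
  power y/\<mu> leaves the exponent y/c.\<close>

lemma dexp_compose_dlog:
  assumes "\<mu> \<noteq> 0" "c \<noteq> 0"
  shows "dexp \<mu> y oo (fps_const (1 / c) * (dlog (\<mu> / c) oo (fps_const c * fps_X)))
    = fps_binomial (y / c) oo (fps_const c * fps_X)"
proof -
  define L where "L = fps_const (1 / c) * (dlog (\<mu> / c) oo (fps_const c * fps_X))"
  have L0: "fps_nth L 0 = 0"
    by (simp add: L_def dlog_def)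
  have "fps_const \<mu> * L = (fps_binomial (\<mu> / c) - 1) oo (fps_const c * fps_X)"
    using assms by (intro fps_ext) (simp add: L_def dlog_def)
  moreover have "dexp \<mu> y oo L = fps_binomial (y / \<mu>) oo (fps_const \<mu> * L)"
    using L0 assms by (simp add: dexp_binomial fps_compose_mult_distrib flip: fps_compose_assoc)
  ultimately have "dexp \<mu> y oo L
      = fps_binomial (y / \<mu>) oo (fps_binomial (\<mu> / c) - 1) oo (fps_const c * fps_X)"
    by (simp add: fps_compose_assoc)
  then show ?thesis
    using assms by (simp add: fps_binomial_compose_binomial L_def)
qed

lemma dexp_eq_compose_dlog:
  assumes "\<mu> \<noteq> 0" "m > 0"
  shows "dexp \<mu> x = (fps_binomial (- (1 / of_nat m)) oo (fps_const (of_nat m) * fps_X))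
    * (Abs_fps (\<lambda>n. ddowling m \<mu> n x / fact n) oo
        (fps_const (1 / of_nat m) * (dlog (\<mu> / of_nat m) oo (fps_const (of_nat m) * fps_X))))"
proof -
  define c where "c = real m"
  define M where "M = fps_const c * fps_X"
  define L where "L = fps_const (1 / c) * (dlog (\<mu> / c) oo M)"
  define s where "s = fps_const (1 / c) * (dexp \<mu> c - 1)"
  have c: "c \<noteq> 0"
    using assms by (simp add: c_def)
  have L0: "fps_nth L 0 = 0" and M0: "fps_nth M 0 = 0"
    by (simp_all add: L_def M_def dlog_def)
  have s0: "fps_nth s 0 = 0"
    by (simp add: s_def dexp_def dfact_def)
  \<comment> \<open>Used twice: y = c gives \<open>1 + M\<close>, hence
    \<open>s oo L = fps_X\<close>; y = 1 gives the prefactor that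
    \<open>fps_binomial (- (1 / c)) oo M\<close> cancels.\<close>
  have exp_L: "dexp \<mu> y oo L = fps_binomial (y / c) oo M" for y
    using dexp_compose_dlog[OF assms(1) c] by (simp add: L_def M_def)
  have "s oo L = fps_const (1 / c) * ((dexp \<mu> c oo L) - 1)"
    using L0 by (simp add: s_def fps_compose_mult_distrib fps_compose_sub_distrib)
  also have "dexp \<mu> c oo L = 1 + M"
    using c M0 by (simp add: exp_L fps_binomial_1 fps_compose_add_distrib)
  finally have sL: "s oo L = fps_X"
    using c by (simp add: M_def flip: mult.assoc)
  have "(fps_binomial (- (1 / c)) oo M) * (Abs_fps (\<lambda>n. ddowling m \<mu> n x / fact n) oo L)
      = (fps_binomial (- (1 / c)) oo M) * (dexp \<mu> 1 * (dexp \<mu> x oo s) oo L)"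
    by (simp add: s_def c_def flip: ddowling_gf)
  also have "\<dots> = ((fps_binomial (- (1 / c)) * fps_binomial (1 / c)) oo M) * (dexp \<mu> x oo (s oo L))"
    using L0 M0 s0 by (simp add: fps_compose_mult_distrib exp_L mult.assoc flip: fps_compose_assoc)
  also have "\<dots> = dexp \<mu> x"
    by (simp add: sL flip: fps_binomial_add_mult)
  finally show ?thesis
    by (simp add: L_def M_def c_def)
qed

text \<open>Applied below at x = -1/m, where the powers of x supply the signs (-1)^i and the factors
  m^(-i).\<close>

lemma gbinomial_stirling1:
  "(x::real) gchoose n = (\<Sum>k\<le>n. of_int (stirling1 n k) * x ^ k) / fact n"
  by (simp add: gbinomial_prod_rev lessThan_atLeast0 flip: stirling1_falling)

theorem theorem11:
  fixes lam x :: real and m n :: nat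
  assumes "lam \<noteq> 0" and "m > 0"
  shows "dfact lam n x =
    (\<Sum>k=0..n. (\<Sum>l=k..n. \<Sum>i=0..n-l.
        of_nat (n choose l) * dstirling1 (lam / of_nat m) l k * of_int (stirling1 (n - l) i) *
        of_nat m ^ (n - k - i) * (-1) ^ i) * ddowling m lam k x)"
proof -
  define c where "c = real m"
  define M where "M = fps_const c * fps_X"
  define L where "L = fps_const (1 / c) * (dlog (lam / c) oo M)"
  define B where "B = fps_binomial (- (1 / c)) oo M"
  have c: "c \<noteq> 0"
    using assms by (simp add: c_def)
  have L0: "fps_nth L 0 = 0"
    by (simp add: L_def M_def dlog_def)
  have M0: "fps_nth M 0 = 0"
    by (simp add: M_def)
  have B_nth: "fps_nth B j = (\<Sum>i=0..j. of_int (stirling1 j i) * c ^ j * (- (1 / c)) ^ i) / fact j" for j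
    by (simp add: B_def M_def gbinomial_stirling1 atMost_atLeast0 sum_distrib_left mult.left_commute mult.assoc)
  have "L ^ k = fps_const ((1 / c) ^ k) * (dlog (lam / c) ^ k oo M)" for k
    using M0 by (simp add: L_def power_mult_distrib fps_compose_power fps_const_power)
  then have L_nth: "fps_nth (L ^ k) l = (1 / c) ^ k * c ^ l * fact k * dstirling1 (lam / c) l k / fact l" for k l
    by (simp add: M_def dstirling1_def)
  have term_eq: "fact n * (1 / fact k * fps_nth (B * L ^ k) n) =
      (\<Sum>l=k..n. \<Sum>i=0..n-l. of_nat (n choose l) * dstirling1 (lam / c) l k *
        of_int (stirling1 (n - l) i) * c ^ (n - k - i) * (-1) ^ i)" for k
  proof -
    have "fps_nth (B * L ^ k) n = (\<Sum>l=0..n. fps_nth (L ^ k) l * fps_nth B (n - l))"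
      by (subst mult.commute) (simp add: fps_mult_nth)
    also have "\<dots> = (\<Sum>l=k..n. fps_nth (L ^ k) l * fps_nth B (n - l))"
      using L0 by (intro sum.mono_neutral_right) (auto simp: fps_nth_power_zero_below)
    finally have "fact n * (1 / fact k * fps_nth (B * L ^ k) n)
        = (\<Sum>l=k..n. fact n * (1 / fact k * (fps_nth (L ^ k) l * fps_nth B (n - l))))"
      by (simp add: sum_distrib_left)
    also have "\<dots> = (\<Sum>l=k..n. \<Sum>i=0..n-l. of_nat (n choose l) * dstirling1 (lam / c) l k *
        of_int (stirling1 (n - l) i) * c ^ (n - k - i) * (-1) ^ i)"
    proof (rule sum.cong[OF refl])
      fix l assume l: "l \<in> {k..n}"
      \<comment> \<open>Since k \<le> l and i \<le> n - l, k + i is at most n, so the natural-number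
        subtraction in \<open>n - k - i\<close> does not truncate.\<close>
      have pow: "(1 / c) ^ k * c ^ l * (c ^ (n - l) * (- (1 / c)) ^ i) = c ^ (n - k - i) * (-1) ^ i"
        if "i \<le> n - l" for i
      proof -
        have "c ^ l * c ^ (n - l) = c ^ (n - k - i) * c ^ k * c ^ i"
        proof -
          have "l + (n - l) = n - k - i + k + i"
            using l that by auto
          then show ?thesis
            by (simp only: flip: power_add)
        qed
        then show ?thesis
          using c by (simp add: power_minus[of "1 / c"] power_divide field_simps)
      qed
      \<comment> \<open>The 1/k! cancels the k! in \<open>L_nth\<close>; n! together with 1/l! from
        \<open>L_nth\<close> and 1/(n-l)! from \<open>B_nth\<close> forms the binomial
        coefficient.\<close>
      have "fact n * (1 / fact k * (fps_nth (L ^ k) l * fps_nth B (n - l)))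
          = of_nat (n choose l) * dstirling1 (lam / c) l k * ((1 / c) ^ k * c ^ l *
            (\<Sum>i=0..n-l. of_int (stirling1 (n - l) i) * c ^ (n - l) * (- (1 / c)) ^ i))"
        using l by (simp add: L_nth B_nth binomial_fact)
      also have "\<dots> = (\<Sum>i=0..n-l. of_nat (n choose l) * dstirling1 (lam / c) l k *
          of_int (stirling1 (n - l) i) * ((1 / c) ^ k * c ^ l * (c ^ (n - l) * (- (1 / c)) ^ i)))"
        by (simp only: sum_distrib_left mult_ac)
      also have "\<dots> = (\<Sum>i=0..n-l. of_nat (n choose l) * dstirling1 (lam / c) l k *
          of_int (stirling1 (n - l) i) * c ^ (n - k - i) * (-1) ^ i)"
        by (intro sum.cong[OF refl], subst pow) (auto simp: mult.assoc)
      finally show "fact n * (1 / fact k * (fps_nth (L ^ k) l * fps_nth B (n - l))) = \<dots>" .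
    qed
    finally show ?thesis .
  qed
  have "dfact lam n x = fact n * fps_nth (dexp lam x) n"
    by (simp add: dexp_def)
  also have "dexp lam x = B * (Abs_fps (\<lambda>n. ddowling m lam n x / fact n) oo L)"
    unfolding B_def L_def M_def c_def using assms by (rule dexp_eq_compose_dlog)
  \<comment> \<open>The composition contributes only up to k = n; each 1/k! comes from the
    exponential generating function of the Dowling polynomials.\<close>
  also have "fact n * fps_nth \<dots> n
      = (\<Sum>k=0..n. fact n * (1 / fact k * fps_nth (B * L ^ k) n) * ddowling m lam k x)"
    using L0 by (simp add: fps_mult_compose_nth sum_distrib_left mult_ac)
  finally show ?thesis
    by (simp only: term_eq c_def)
qed

end
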